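(* Let $n>1$, $d>1$ be integers, let $\mathbb{E}=\mathbb{R}[X_1,\dots,X_n]_d$ be the space of real homogeneous polynomials of degree $d$ in $n$ variables, equipped with an arbitrary scalar product, let $N=\dim\mathbb{E}$, and let $(E_1,\dots,E_N)$ be an orthonormal basis of $\mathbb{E}$ for this scalar product. Let $B(x)$ be the $n\times N$ matrix $$B(x)=\left(\frac{\partial E_j(x)}{\partial x_i}\right)_{1\le i\le n,\ 1\le j\le N}.$$ Then for every $P\in\mathbb{E}$, the distance from $P$ to the real discriminant $\Delta$, for the norm associated with the given scalar product, is $$\mathrm{dist}(P,\Delta)=\min_{x\in\mathcal{S}^{n-1}}\sqrt{{}^t\nabla P(x)\,M(x)\,\nabla P(x)}\qquad\text{with } M(x)=\big(B(x)\,{}^tB(x)\big)^{-1}.$$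
   Context: $\mathcal{S}^{n-1}$ is the Euclidean unit sphere of $\mathbb{R}^n$. The real discriminant $\Delta\subset\mathbb{E}$ is the set of $P\in\mathbb{E}$ for which there exists $x\in\mathcal{S}^{n-1}$ with $P(x)=0$ and $\nabla P(x)=0$. ${}^tA$ denotes the transpose of $A$; $\nabla P(x)$ is the gradient as a column vector. $\mathrm{dist}(P,\Delta)=\inf_{Q\in\Delta}\|P-Q\|$. *)

theory Defs
  imports "HOL-Analysis.Analysis" "HOL-Analysis.Finite_Function_Topology"
begin

(* A polynomial in the variables X_i (i :: 'n) is its finitely supported family of
   coefficients; a monomial is its finitely supported family of exponents.  The vector
   space structure is the coefficientwise one of HOL-Analysis.Finite_Function_Topology;
   the norm defined there is never used. *)
type_synonym 'n rpoly = "('n \<Rightarrow>\<^sub>0 nat) \<Rightarrow>\<^sub>0 real"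

definition eval :: "'n::finite rpoly \<Rightarrow> real ^ 'n \<Rightarrow> real" where
  "eval P x = (\<Sum>m\<in>Poly_Mapping.keys P.
     Poly_Mapping.lookup P m * (\<Prod>i\<in>UNIV. x $ i ^ Poly_Mapping.lookup m i))"

definition homogeneous :: "nat \<Rightarrow> 'n::finite rpoly set" where
  "homogeneous d =
     {P. \<forall>m\<in>Poly_Mapping.keys P. (\<Sum>i\<in>UNIV. Poly_Mapping.lookup m i) = d}"

definition partial :: "'n::finite \<Rightarrow> 'n rpoly \<Rightarrow> real ^ 'n \<Rightarrow> real" where
  "partial i P x = frechet_derivative (eval P) (at x) (axis i 1)"

definition gradient :: "'n::finite rpoly \<Rightarrow> real ^ 'n \<Rightarrow> real ^ 'n" where
  "gradient P x = (\<chi> i. partial i P x)"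

definition real_discriminant :: "nat \<Rightarrow> 'n::finite rpoly set" where
  "real_discriminant d =
     {P \<in> homogeneous d. \<exists>x\<in>sphere 0 1. eval P x = 0 \<and> gradient P x = 0}"

(* The form ip is a function on all polynomials, but only its values on V matter. *)
definition scalar_product_on :: "'a::real_vector set \<Rightarrow> ('a \<Rightarrow> 'a \<Rightarrow> real) \<Rightarrow> bool" where
  "scalar_product_on V ip \<longleftrightarrow>
     (\<forall>p\<in>V. \<forall>q\<in>V. ip p q = ip q p) \<and>
     (\<forall>p\<in>V. \<forall>q\<in>V. \<forall>r\<in>V. ip (p + q) r = ip p r + ip q r) \<and>
     (\<forall>c. \<forall>p\<in>V. \<forall>q\<in>V. ip (c *\<^sub>R p) q = c * ip p q) \<and>
     (\<forall>p\<in>V. p \<noteq> 0 \<longrightarrow> 0 < ip p p)"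

definition ip_norm :: "('a \<Rightarrow> 'a \<Rightarrow> real) \<Rightarrow> 'a \<Rightarrow> real" where
  "ip_norm ip p = sqrt (ip p p)"

definition ip_dist :: "('a::real_vector \<Rightarrow> 'a \<Rightarrow> real) \<Rightarrow> 'a \<Rightarrow> 'a set \<Rightarrow> real" where
  "ip_dist ip p S = (INF q\<in>S. ip_norm ip (p - q))"

definition orthonormal_basis_on ::
    "'a::real_vector set \<Rightarrow> ('a \<Rightarrow> 'a \<Rightarrow> real) \<Rightarrow> ('k \<Rightarrow> 'a) \<Rightarrow> bool" where
  "orthonormal_basis_on V ip b \<longleftrightarrow>
     independent (range b) \<and> span (range b) = V \<and>
     (\<forall>j k. ip (b j) (b k) = (if j = k then 1 else 0))"

definition derivative_matrix ::
    "('k::finite \<Rightarrow> 'n::finite rpoly) \<Rightarrow> real ^ 'n \<Rightarrow> real ^ 'k ^ 'n" where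
  "derivative_matrix b x = (\<chi> i j. partial i (b j) x)"

lemma lookup_scaleR:
  "Poly_Mapping.lookup (c *\<^sub>R p) m = c *\<^sub>R Poly_Mapping.lookup p m"
proof -
  have "finite {k. c *\<^sub>R Poly_Mapping.lookup p k \<noteq> 0}"
    by (rule finite_subset[OF _ finite_keys[of p]]) (auto simp: in_keys_iff)
  then show ?thesis
    unfolding scaleR_poly_mapping_def by (simp add: Abs_poly_mapping_inverse)
qed

lemma subspace_homogeneous: "subspace (homogeneous d)"
  unfolding subspace_def homogeneous_def
  by (auto simp: in_keys_iff lookup_add lookup_scaleR)

lemma eval_differentiable: "eval P differentiable (at x)"
proof -
  have pow: "(\<lambda>x. x $ i ^ k) differentiable (at x)" for i k
    by (intro differentiable_power bounded_linear_imp_differentiable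
        bounded_linear_vec_nth)
  have prd: "(\<lambda>x. \<Prod>i\<in>A. x $ i ^ k i) differentiable (at x)"
    if "finite A" for A and k :: "'a \<Rightarrow> nat"
    using that by induction (auto intro!: differentiable_mult pow)
  show ?thesis
    unfolding eval_def
    by (intro differentiable_sum ballI finite_keys differentiable_mult
        differentiable_const prd finite)
qed

end

theory Submission
  imports Defs
begin

text \<open>
  In the coordinates given by the orthonormal basis, \<open>\<nabla>Q(x) = B(x) c\<close> when \<open>Q\<close> has
  coordinate vector \<open>c\<close>, and by Euler's identity a vanishing gradient forces \<open>Q(x) = 0\<close>.
  Hence the discriminant is the union over the sphere of the kernels of \<open>B(x)\<close>.  The matrix
  \<open>B(x)\<close> is onto because some \<open>x\<^sub>k \<noteq> 0\<close> and the gradients at \<open>x\<close> of the monomials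
  \<open>X\<^sub>k\<^sup>d\<^sup>-\<^sup>1 X\<^sub>i\<close> span the whole space; so the distance from \<open>p\<close> to the kernel of \<open>B(x)\<close> is the
  norm of the projection of \<open>p\<close> to the row space, which is the square root in the formula.
  The distance to the union is attained by compactness of the sphere.
\<close>

section \<open>Evaluation and gradient\<close>

text \<open>Lets polynomials with different supports be summed over one common index set, which
  linearity of evaluation requires.\<close>

lemma eval_superset:
  assumes "finite S" "Poly_Mapping.keys P \<subseteq> S"
  shows "eval P x = (\<Sum>m\<in>S. Poly_Mapping.lookup P m * (\<Prod>i\<in>UNIV. x $ i ^ Poly_Mapping.lookup m i))"
  unfolding eval_def
  by (rule sum.mono_neutral_left[OF assms]) (auto simp: in_keys_iff)

lemma linear_eval: "linear (\<lambda>P. eval P x)"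
proof (rule linearI)
  fix P Q :: "'n::finite rpoly" and x :: "real ^ 'n"
  let ?S = "Poly_Mapping.keys P \<union> Poly_Mapping.keys Q"
  have "Poly_Mapping.keys (P + Q) \<subseteq> ?S"
    by (rule Poly_Mapping.keys_add)
  then show "eval (P + Q) x = eval P x + eval Q x"
    by (simp add: eval_superset[of ?S] lookup_add algebra_simps sum.distrib)
next
  fix c and P :: "'n::finite rpoly" and x :: "real ^ 'n"
  have "Poly_Mapping.keys (c *\<^sub>R P) \<subseteq> Poly_Mapping.keys P"
    by (auto simp: in_keys_iff lookup_scaleR)
  then show "eval (c *\<^sub>R P) x = c *\<^sub>R eval P x"
    by (simp add: eval_superset[of "Poly_Mapping.keys P"] lookup_scaleR sum_distrib_left mult.assoc)
qed

text \<open>The truncated exponent \<open>k - 1\<close> is harmless at \<open>k = 0\<close>, where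
  the factor \<open>real k\<close> vanishes. This explicit form gives both continuity of the partial
  derivatives and Euler's identity.\<close>

lemma eval_has_derivative:
  "(eval P has_derivative (\<lambda>h. \<Sum>m\<in>Poly_Mapping.keys P. Poly_Mapping.lookup P m *
     (\<Sum>i\<in>UNIV. (real (Poly_Mapping.lookup m i) * h $ i * x $ i ^ (Poly_Mapping.lookup m i - 1)) *
        (\<Prod>j\<in>UNIV - {i}. x $ j ^ Poly_Mapping.lookup m j)))) (at x)"
proof -
  have nth: "((\<lambda>x. x $ i) has_derivative (\<lambda>h. h $ i)) (at x)" for i :: 'a
    by (rule bounded_linear.has_derivative[OF bounded_linear_vec_nth has_derivative_ident])
  have pow: "((\<lambda>x. x $ i ^ k) has_derivative (\<lambda>h. real k * h $ i * x $ i ^ (k - 1))) (at x)"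
    for i :: 'a and k
    using has_derivative_power[OF nth, where n = k] by (simp add: algebra_simps)
  show ?thesis
    unfolding eval_def
    by (intro has_derivative_sum has_derivative_mult_right has_derivative_prod pow)
qed

lemma partial_eq:
  "partial i P x = (\<Sum>m\<in>Poly_Mapping.keys P. Poly_Mapping.lookup P m *
     (real (Poly_Mapping.lookup m i) * x $ i ^ (Poly_Mapping.lookup m i - 1) *
        (\<Prod>j\<in>UNIV - {i}. x $ j ^ Poly_Mapping.lookup m j)))"
proof -
  have *: "(\<Sum>k\<in>UNIV. real (Poly_Mapping.lookup m k) * axis i 1 $ k * x $ k ^ (Poly_Mapping.lookup m k - 1) *
        (\<Prod>j\<in>UNIV - {k}. x $ j ^ Poly_Mapping.lookup m j)) =
     real (Poly_Mapping.lookup m i) * x $ i ^ (Poly_Mapping.lookup m i - 1) *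
        (\<Prod>j\<in>UNIV - {i}. x $ j ^ Poly_Mapping.lookup m j)" for m
    by (subst sum.remove[of _ i]) (auto simp: axis_def intro!: sum.neutral)
  show ?thesis
    unfolding partial_def frechet_derivative_at[OF eval_has_derivative, symmetric] * ..
qed

text \<open>Coordinate-free form of the gradient: by uniqueness of derivatives, gradients can be
  read off from any known derivative.\<close>

lemma eval_has_derivative_gradient: "(eval P has_derivative (\<lambda>h. gradient P x \<bullet> h)) (at x)"
proof -
  let ?D = "frechet_derivative (eval P) (at x)"
  have D: "(eval P has_derivative ?D) (at x)"
    using eval_differentiable frechet_derivative_works by blast
  then have lin: "linear ?D"
    by (rule has_derivative_linear)
  have "?D = (\<lambda>h. gradient P x \<bullet> h)"
  proof
    fix h
    have "?D h = ?D (\<Sum>i\<in>UNIV. h $ i *\<^sub>R axis i 1)"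
      using basis_expansion[of h] by (simp add: scalar_mult_eq_scaleR)
    also have "\<dots> = gradient P x \<bullet> h"
      by (simp add: linear_sum[OF lin] linear_scale[OF lin] gradient_def inner_vec_def partial_def mult.commute)
    finally show "?D h = gradient P x \<bullet> h" .
  qed
  with D show ?thesis by simp
qed

lemma gradient_unique:
  assumes "(eval P has_derivative (\<lambda>h. v \<bullet> h)) (at x)"
  shows "gradient P x = v"
  using has_derivative_unique[OF eval_has_derivative_gradient assms]
  by (metis vector_eq_rdot)

lemma linear_gradient: "linear (\<lambda>P. gradient P x)"
proof (rule linearI)
  fix P Q :: "'n::finite rpoly" and x :: "real ^ 'n"
  have "eval (P + Q) = (\<lambda>x. eval P x + eval Q x)"
    using linear_add[OF linear_eval] by blast
  then show "gradient (P + Q) x = gradient P x + gradient Q x"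
    by (intro gradient_unique)
      (simp add: inner_add_left has_derivative_add eval_has_derivative_gradient)
next
  fix c and P :: "'n::finite rpoly" and x :: "real ^ 'n"
  have "eval (c *\<^sub>R P) = (\<lambda>x. c * eval P x)"
    using linear_scale[OF linear_eval] by fastforce
  then show "gradient (c *\<^sub>R P) x = c *\<^sub>R gradient P x"
    by (intro gradient_unique)
      (simp add: has_derivative_mult_right eval_has_derivative_gradient)
qed

lemma continuous_on_partial: "continuous_on S (partial i P)"
  unfolding partial_eq[abs_def] by (intro continuous_intros)

text \<open>Apply the explicit derivative to the direction \<open>x\<close> itself: each variable
  reproduces the monomial, weighted by its exponent, and the exponents add up to
  \<open>d\<close>.\<close>

lemma euler_identity:
  assumes "P \<in> homogeneous d"
  shows "gradient P x \<bullet> x = real d * eval P x"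
proof -
  have mon: "(\<Sum>i\<in>UNIV. (real (Poly_Mapping.lookup m i) * x $ i * x $ i ^ (Poly_Mapping.lookup m i - 1)) *
        (\<Prod>j\<in>UNIV - {i}. x $ j ^ Poly_Mapping.lookup m j)) =
     real d * (\<Prod>j\<in>UNIV. x $ j ^ Poly_Mapping.lookup m j)" if m: "m \<in> Poly_Mapping.keys P" for m
  proof -
    have "(real (Poly_Mapping.lookup m i) * x $ i * x $ i ^ (Poly_Mapping.lookup m i - 1)) *
        (\<Prod>j\<in>UNIV - {i}. x $ j ^ Poly_Mapping.lookup m j) =
      real (Poly_Mapping.lookup m i) * (\<Prod>j\<in>UNIV. x $ j ^ Poly_Mapping.lookup m j)" for i
      by (cases "Poly_Mapping.lookup m i") (simp_all add: prod.remove[of UNIV i])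
    moreover have "(\<Sum>i\<in>UNIV. real (Poly_Mapping.lookup m i)) = real d"
      using assms m unfolding homogeneous_def by (auto simp flip: of_nat_sum)
    ultimately show ?thesis
      by (metis (no_types, lifting) sum.cong sum_distrib_right)
  qed
  have "gradient P x \<bullet> x = (\<Sum>m\<in>Poly_Mapping.keys P. Poly_Mapping.lookup P m *
     (\<Sum>i\<in>UNIV. (real (Poly_Mapping.lookup m i) * x $ i * x $ i ^ (Poly_Mapping.lookup m i - 1)) *
        (\<Prod>j\<in>UNIV - {i}. x $ j ^ Poly_Mapping.lookup m j)))"
    by (rule fun_cong[OF has_derivative_unique[OF eval_has_derivative_gradient eval_has_derivative]])
  also have "\<dots> = real d * eval P x"
    unfolding eval_def sum_distrib_left[of "real d"]
    by (intro sum.cong refl) (simp only: mon mult.left_commute)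
  finally show ?thesis .
qed

text \<open>Surjectivity of \<open>B(x)\<close> in dual form. Testing against the monomials
  \<open>Q i\<close> gives one equation per index; the one for \<open>i = k\<close> forces
  \<open>v $ k = 0\<close>, and the others then reduce to
  \<open>x $ k ^ (d - 1) * v $ i = 0\<close>.\<close>

lemma gradient_orthogonal_imp_zero:
  fixes x v :: "real ^ 'n::finite"
  assumes "d > 0" "x \<noteq> 0"
    and orth: "\<And>Q :: 'n rpoly. Q \<in> homogeneous d \<Longrightarrow> gradient Q x \<bullet> v = 0"
  shows "v = 0"
proof -
  obtain k where k: "x $ k \<noteq> 0"
    using \<open>x \<noteq> 0\<close> by (auto simp: vec_eq_iff)
  define e where "e i = Poly_Mapping.single k (d - 1) + Poly_Mapping.single i (1::nat)" for i :: 'n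
  define Q :: "'n \<Rightarrow> 'n rpoly" where "Q i = Poly_Mapping.single (e i) 1" for i
  have lookup_e: "Poly_Mapping.lookup (e i) j = (if j = k then d - 1 else 0) + (if j = i then 1 else 0)" for i j
    by (auto simp: e_def lookup_add lookup_single when_def)
  have "Q i \<in> homogeneous d" for i
    using \<open>d > 0\<close> by (simp add: homogeneous_def Q_def lookup_e sum.distrib)
  then have zero: "gradient (Q i) x \<bullet> v = 0" for i
    by (rule orth)
  \<comment> \<open>Moves the conditional out of the exponent, so that the product over all
    variables collapses to the factors at \<open>k\<close> and \<open>i\<close>.\<close>
  have pow_if: "a ^ (if c then n else 0) = (if c then a ^ n else 1)" for a :: real and c and n :: nat
    by simp
  have "eval (Q i) = (\<lambda>y. y $ k ^ (d - 1) * y $ i)" for i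
    by (rule ext) (simp add: eval_def Q_def lookup_e power_add prod.distrib pow_if)
  moreover have nth: "((\<lambda>x. x $ i) has_derivative (\<lambda>h. h $ i)) (at x)" for i :: 'n
    by (rule bounded_linear.has_derivative[OF bounded_linear_vec_nth has_derivative_ident])
  ultimately have "(eval (Q i) has_derivative
      (\<lambda>h. x $ k ^ (d - 1) * h $ i + real (d - 1) * h $ k * x $ k ^ (d - 2) * x $ i)) (at x)" for i
    using has_derivative_mult[OF has_derivative_power[OF nth[of k], of "d - 1"] nth[of i]]
    by (simp add: algebra_simps numeral_2_eq_2)
  from has_derivative_unique[OF eval_has_derivative_gradient this]
  have "gradient (Q i) x \<bullet> v =
      x $ k ^ (d - 1) * v $ i + real (d - 1) * v $ k * x $ k ^ (d - 2) * x $ i" for i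
    by (rule fun_cong)
  then have eq: "x $ k ^ (d - 1) * v $ i + real (d - 1) * v $ k * x $ k ^ (d - 2) * x $ i = 0" for i
    using zero by simp
  \<comment> \<open>For \<open>d = 1\<close> the exponent \<open>d - 2\<close> is truncated to 0,
    but the factor \<open>real (d - 1)\<close> makes both sides vanish.\<close>
  have "real (d - 1) * x $ k ^ (d - 2) * x $ k = real (d - 1) * x $ k ^ (d - 1)"
    by (cases "d < 2") (auto simp: numeral_2_eq_2 Suc_diff_Suc simp flip: power_Suc2)
  then have "real d * x $ k ^ (d - 1) * v $ k =
      x $ k ^ (d - 1) * v $ k + (real (d - 1) * x $ k ^ (d - 2) * x $ k) * v $ k"
    using \<open>d > 0\<close> by (simp add: of_nat_diff left_diff_distrib)
  also have "\<dots> = 0"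
    using eq[of k] by (simp only: ac_simps)
  finally have "v $ k = 0"
    using k \<open>d > 0\<close> by simp
  then show "v = 0"
    using eq k by (simp add: vec_eq_iff)
qed

section \<open>Distance to a kernel\<close>

lemma inner_transpose:
  fixes A :: "real ^ 'k ^ 'n"
  shows "(transpose A *v v) \<bullet> y = v \<bullet> (A *v y)"
  by (simp add: dot_lmul_matrix)

lemma matrix_mult_inv_right:
  assumes "invertible A"
  shows "A ** matrix_inv A = mat 1"
  using assms unfolding invertible_def matrix_inv_def by (rule someI2_ex) simp

text \<open>The quadratic form of the Gram matrix at \<open>v\<close> is the squared norm of
  \<open>transpose B *v v\<close>, so its kernel is trivial.\<close>

lemma invertible_mult_transpose:
  fixes B :: "real ^ 'k ^ 'n"
  assumes "\<And>v. transpose B *v v = 0 \<Longrightarrow> v = 0"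
  shows "invertible (B ** transpose B)"
proof -
  have "v = 0" if "(B ** transpose B) *v v = 0" for v
  proof -
    have "(transpose B *v v) \<bullet> (transpose B *v v) = v \<bullet> ((B ** transpose B) *v v)"
      unfolding inner_transpose matrix_vector_mul_assoc ..
    with that assms show ?thesis by simp
  qed
  then show ?thesis
    by (metis invertible_left_inverse matrix_left_invertible_ker)
qed

text \<open>The vector \<open>u\<close> in the proof is the orthogonal projection of
  \<open>p\<close> onto the row space of \<open>B\<close>; thus \<open>p - u\<close> is the point of
  the kernel nearest to \<open>p\<close>, and \<open>r\<close> is the norm of
  \<open>u\<close>.\<close>

lemma distance_to_kernel:
  fixes B :: "real ^ 'k ^ 'n" and p :: "real ^ 'k"
  assumes "invertible (B ** transpose B)"
  defines "r \<equiv> sqrt ((B *v p) \<bullet> (matrix_inv (B ** transpose B) *v (B *v p)))"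
  shows "\<exists>c. B *v c = 0 \<and> norm (p - c) = r"
    and "B *v c = 0 \<Longrightarrow> r \<le> norm (p - c)"
proof -
  define w where "w = matrix_inv (B ** transpose B) *v (B *v p)"
  define u where "u = transpose B *v w"
  have "(B ** transpose B) *v w = B *v p"
    using matrix_mult_inv_right[OF assms(1)] by (metis w_def matrix_vector_mul_assoc matrix_vector_mul_lid)
  then have Bu: "B *v u = B *v p"
    by (simp only: u_def matrix_vector_mul_assoc)
  have inner_u: "y \<bullet> u = (B *v y) \<bullet> w" for y
    unfolding u_def inner_commute[of y] inner_transpose by (rule inner_commute)
  have r: "r = norm u"
    unfolding r_def norm_eq_sqrt_inner inner_u Bu w_def ..
  show "\<exists>c. B *v c = 0 \<and> norm (p - c) = r"
    by (rule exI[of _ "p - u"]) (simp add: matrix_vector_mult_diff_distrib Bu r)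
  show "r \<le> norm (p - c)" if "B *v c = 0"
  proof -
    \<comment> \<open>Both \<open>c\<close> and \<open>p - u\<close> lie in the kernel, hence are
      orthogonal to \<open>u\<close>.\<close>
    have "norm u * norm u = (p - c) \<bullet> u"
      using inner_u[of u] that
      by (simp add: inner_u Bu matrix_vector_mult_diff_distrib flip: power2_norm_eq_inner power2_eq_square)
    also have "\<dots> \<le> norm (p - c) * norm u"
      by (rule norm_cauchy_schwarz)
    finally show ?thesis
      unfolding r by (cases "norm u = 0") (auto simp: mult_le_cancel_right)
  qed
qed

text \<open>The union of the kernels is unbounded, but 0 lies in each of them at distance
  \<open>norm p\<close> from \<open>p\<close>. Only the closed ball of that radius matters, and the
  pairs (parameter, kernel vector) in it form a compact set.\<close>

lemma distance_to_kernels_attained: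
  fixes B :: "'a::metric_space \<Rightarrow> real ^ 'k ^ 'n" and p :: "real ^ 'k"
  assumes "compact S" "S \<noteq> {}" and cont: "continuous_on UNIV B"
  obtains x c where "x \<in> S" "B x *v c = 0"
    "\<And>y c'. y \<in> S \<Longrightarrow> B y *v c' = 0 \<Longrightarrow> norm (p - c) \<le> norm (p - c')"
proof -
  define T where "T = (S \<times> cball p (norm p)) \<inter> {z. B (fst z) *v snd z = 0}"
  have "continuous_on UNIV (\<lambda>z. B (fst z) *v snd z)"
    unfolding matrix_vector_mult_def
    by (intro continuous_intros continuous_on_compose2[OF cont]) auto
  then have "closed {z. B (fst z) *v snd z = 0}"
    by (intro closed_Collect_eq) auto
  then have "compact T"
    unfolding T_def using \<open>compact S\<close> by (intro compact_Int_closed compact_Times) auto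
  obtain x0 where x0: "x0 \<in> S"
    using \<open>S \<noteq> {}\<close> by blast
  then have "(x0, 0) \<in> T"
    by (simp add: T_def)
  have "continuous_on T (\<lambda>z. norm (p - snd z))"
    by (intro continuous_intros)
  with \<open>compact T\<close> \<open>(x0, 0) \<in> T\<close>
  obtain z where z: "z \<in> T" "\<And>z'. z' \<in> T \<Longrightarrow> norm (p - snd z) \<le> norm (p - snd z')"
    by (metis continuous_attains_inf empty_iff)
  show ?thesis
  proof (rule that[of "fst z" "snd z"])
    show "fst z \<in> S" "B (fst z) *v snd z = 0"
      using z(1) by (auto simp: T_def)
    fix y c' assume y: "y \<in> S" "B y *v c' = 0"
    show "norm (p - snd z) \<le> norm (p - c')"
    proof (cases "norm (p - c') \<le> norm p")
      case True
      then have "(y, c') \<in> T"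
        using y by (simp add: T_def dist_norm)
      from z(2)[OF this] show ?thesis by simp
    next
      case False
      then show ?thesis
        using z(2)[OF \<open>(x0, 0) \<in> T\<close>] by simp
    qed
  qed
qed

section \<open>Orthonormal coordinates\<close>

text \<open>Since \<open>ip\<close> is constrained only on \<open>V\<close>, membership in
  \<open>V\<close> has to be carried through the induction.\<close>

lemma scalar_product_sum_left:
  assumes "subspace V" "scalar_product_on V ip" "finite A"
    and "\<And>j. j \<in> A \<Longrightarrow> u j \<in> V" "q \<in> V"
  shows "ip (\<Sum>j\<in>A. c j *\<^sub>R u j) q = (\<Sum>j\<in>A. c j * ip (u j) q)"
  using assms(3,4)
proof (induction A)
  case empty
  have "ip (0 *\<^sub>R q) q = 0 * ip q q"
    using assms(2,5) unfolding scalar_product_on_def by blast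
  then show ?case by simp
next
  case (insert j A)
  have "(\<Sum>j\<in>A. c j *\<^sub>R u j) \<in> V"
    using insert.prems by (intro subspace_sum[OF \<open>subspace V\<close>] subspace_scale[OF \<open>subspace V\<close>]) auto
  moreover have "c j *\<^sub>R u j \<in> V" "u j \<in> V"
    using insert.prems subspace_scale[OF \<open>subspace V\<close>] by auto
  moreover have "ip (c j *\<^sub>R u j) q = c j * ip (u j) q"
    using assms(2,5) \<open>u j \<in> V\<close> unfolding scalar_product_on_def by blast
  ultimately show ?case
    using assms(2,5) insert unfolding scalar_product_on_def by auto
qed

text \<open>Parseval's identity: passing to coordinates is an isometry, which moves the distance
  problem into Euclidean space.\<close>

lemma orthonormal_basis_ip:
  fixes b :: "'k::finite \<Rightarrow> 'a::real_vector" and c :: "real ^ 'k"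
  assumes V: "subspace V" and ip: "scalar_product_on V ip" and b: "orthonormal_basis_on V ip b"
  defines "p \<equiv> \<Sum>j\<in>UNIV. c $ j *\<^sub>R b j"
  shows "ip p p = c \<bullet> c"
proof -
  have bV: "b j \<in> V" for j
    using b span_base[of "b j" "range b"] unfolding orthonormal_basis_on_def by auto
  have pV: "p \<in> V"
    unfolding p_def by (intro subspace_sum[OF V] subspace_scale[OF V] bV)
  have "ip (b j) p = c $ j" for j
  proof -
    have "\<forall>p\<in>V. \<forall>q\<in>V. ip p q = ip q p"
      using ip unfolding scalar_product_on_def by (rule conjunct1)
    then have "ip (b j) p = ip p (b j)"
      using bV pV by blast
    also have "\<dots> = (\<Sum>i\<in>UNIV. c $ i * ip (b i) (b j))"
      unfolding p_def by (rule scalar_product_sum_left[OF V ip]) (auto simp: bV)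
    also have "\<dots> = c $ j"
    proof -
      have "ip (b i) (b j) = (if i = j then 1 else 0)" for i
        using b unfolding orthonormal_basis_on_def by blast
      then show ?thesis
        by (subst sum.remove[of _ j]) (auto intro!: sum.neutral)
    qed
    finally show ?thesis .
  qed
  moreover have "ip p p = (\<Sum>j\<in>UNIV. c $ j * ip (b j) p)"
    using scalar_product_sum_left[OF V ip finite bV pV, of "($) c"] unfolding p_def by simp
  ultimately show ?thesis
    by (simp add: inner_vec_def)
qed

lemma orthonormal_basis_range:
  fixes b :: "'k::finite \<Rightarrow> 'a::real_vector"
  assumes "orthonormal_basis_on V ip b"
  shows "V = range (\<lambda>c :: real ^ 'k. \<Sum>j\<in>UNIV. c $ j *\<^sub>R b j)" (is "V = range ?L")
proof
  have span: "V = span (range b)"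
    using assms by (simp add: orthonormal_basis_on_def)
  have lin: "linear ?L"
    by (rule linearI) (simp_all add: algebra_simps sum.distrib scaleR_sum_right)
  have "b j = ?L (axis j 1)" for j
    by (simp add: axis_def if_distribR cong: if_cong)
      (subst sum.remove[of _ j], auto intro!: sum.neutral)
  then have "range b \<subseteq> range ?L" by blast
  then show "V \<subseteq> range ?L"
    unfolding span using linear_subspace_image[OF lin subspace_UNIV] by (rule span_minimal)
  show "range ?L \<subseteq> V"
    unfolding span by (intro image_subsetI span_sum span_scale span_base rangeI)
qed

section \<open>Distance to the real discriminant\<close>

theorem lemma3p2:
  fixes d :: nat
    and ip :: "'n::finite rpoly \<Rightarrow> 'n rpoly \<Rightarrow> real"
    and b :: "'N::finite \<Rightarrow> 'n rpoly"
    and P :: "'n rpoly"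
  assumes "CARD('n) > 1"
    and "d > 1"
    and "scalar_product_on (homogeneous d) ip"
    and "CARD('N) = dim (homogeneous d :: 'n rpoly set)"
    and "orthonormal_basis_on (homogeneous d) ip b"
    and "P \<in> homogeneous d"
  shows "let B = derivative_matrix b;
             M = (\<lambda>x. matrix_inv (B x ** transpose (B x)));
             f = (\<lambda>x. sqrt (gradient P x \<bullet> (M x *v gradient P x)))
         in (\<forall>x\<in>sphere 0 1. invertible (B x ** transpose (B x))) \<and>
            (\<exists>x\<in>sphere 0 1. ip_dist ip P (real_discriminant d) = f x) \<and>
            (\<forall>x\<in>sphere 0 1. ip_dist ip P (real_discriminant d) \<le> f x)"
proof -
  define B where "B = derivative_matrix b"
  define f where "f x = sqrt (gradient P x \<bullet> (matrix_inv (B x ** transpose (B x)) *v gradient P x))" for x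
  define L where "L c = (\<Sum>j\<in>UNIV. c $ j *\<^sub>R b j)" for c :: "real ^ 'N"
  let ?S = "sphere 0 1 :: (real ^ 'n) set"
  have hom: "homogeneous d = range L"
    using orthonormal_basis_range[OF assms(5)] unfolding L_def .
  have norm_L: "ip_norm ip (L c) = norm c" for c
    using orthonormal_basis_ip[OF subspace_homogeneous assms(3,5)]
    by (simp add: ip_norm_def L_def norm_eq_sqrt_inner)
  have diff_L: "L p - L c = L (p - c)" for p c
    by (simp add: L_def scaleR_diff_left sum_subtractf)
  have grad_L: "gradient (L c) x = B x *v c" for c x
  proof -
    have "gradient (L c) x = (\<Sum>j\<in>UNIV. c $ j *\<^sub>R gradient (b j) x)"
      by (simp add: L_def linear_sum[OF linear_gradient] linear_scale[OF linear_gradient])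
    then show ?thesis
      by (simp add: B_def vec_eq_iff matrix_vector_mult_def derivative_matrix_def gradient_def mult.commute)
  qed
  have disc: "real_discriminant d = L ` {c. \<exists>x\<in>?S. B x *v c = 0}"
  proof -
    \<comment> \<open>Euler's identity, divided by the nonzero degree.\<close>
    have "eval (L c) x = 0" if "gradient (L c) x = 0" for c x
      using euler_identity[of "L c" d x] that hom \<open>d > 1\<close> by simp
    then show ?thesis
      unfolding real_discriminant_def hom grad_L[symmetric] by blast
  qed
  have inv: "invertible (B x ** transpose (B x))" if "x \<in> ?S" for x
  proof (rule invertible_mult_transpose)
    fix v assume v: "transpose (B x) *v v = 0"
    have "gradient Q x \<bullet> v = 0" if Q: "Q \<in> homogeneous d" for Q
    proof -
      obtain c where "Q = L c"
        using Q unfolding hom by (rule rangeE)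
      \<comment> \<open>A vector killed by the transpose is orthogonal to the range of
        \<open>B x\<close>, that is, to all gradients at \<open>x\<close>.\<close>
      then have "gradient Q x \<bullet> v = c \<bullet> (transpose (B x) *v v)"
        by (simp only: grad_L inner_commute[of c] inner_transpose inner_commute[of _ v])
      then show ?thesis
        by (simp only: v inner_zero_right)
    qed
    then show "v = 0"
      using \<open>d > 1\<close> \<open>x \<in> ?S\<close> by (intro gradient_orthogonal_imp_zero[of d x]) auto
  qed
  obtain p where P: "P = L p"
    using assms(6) unfolding hom by (rule rangeE)
  have f: "f x = sqrt ((B x *v p) \<bullet> (matrix_inv (B x ** transpose (B x)) *v (B x *v p)))" for x
    by (simp add: f_def P grad_L)
  have "continuous_on UNIV B"
    unfolding B_def derivative_matrix_def[abs_def]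
    by (intro continuous_on_vec_lambda continuous_on_partial)
  \<comment> \<open>Any coordinate vector shows that the sphere is nonempty.\<close>
  moreover have "axis undefined 1 \<in> ?S"
    by simp
  ultimately obtain x c where xc: "x \<in> ?S" "B x *v c = 0"
    and min: "\<And>y c'. y \<in> ?S \<Longrightarrow> B y *v c' = 0 \<Longrightarrow> norm (p - c) \<le> norm (p - c')"
    using distance_to_kernels_attained[of ?S B p] compact_sphere by blast
  have dist: "ip_dist ip P (real_discriminant d) = norm (p - c)"
    unfolding ip_dist_def disc image_image P diff_L norm_L
    using xc min by (intro cInf_eq_minimum imageI) auto
  have le: "norm (p - c) \<le> f y" if y: "y \<in> ?S" for y
    using distance_to_kernel(1)[OF inv[OF y], of p] min[OF y] unfolding f by metis
  \<comment> \<open>As \<open>c\<close> lies in the kernel at \<open>x\<close>, the distance to that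
    single kernel is at most \<open>norm (p - c)\<close>; with \<open>le\<close>, the same
    \<open>x\<close> therefore minimizes \<open>f\<close>.\<close>
  have "f x \<le> norm (p - c)"
    using distance_to_kernel(2)[OF inv[OF xc(1)] xc(2), of p] unfolding f .
  with le[OF xc(1)] have "norm (p - c) = f x" by simp
  then show ?thesis
    using inv xc(1) dist le unfolding Let_def B_def[symmetric] f_def[symmetric] by auto
qed

end
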